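(* Let $G$ be a finite connected nonbipartite regular graph (loops and multiple edges allowed) with vertex set $V$ and vertex degree $d(v)=q+1\ge 3$ for all $v\in V$. There is a constant $C_G>0$ depending only on $G$ such that for every function $f:V\to\mathbb{R}$ there is a number $\beta_{\max}\in[q^{-1/2},1)$ such that both of the following hold with these same constants: (i) for every directed edge $a$ in $G$ and every integer $r\ge 0$, $\big|M_{r,a}(f)-\frac{1}{|V|}\sum_{v\in V}f(v)\big|\le C_G\|f\|_2\beta_{\max}^{\,r}$; (ii) for every geodesic $\gamma=(\ldots,v_{-1},v_0,v_1,\ldots)$ in the universal covering tree $\widetilde G$ and every integer $r\ge0$, $$\Big|\frac{1}{|\mathcal{H}_{\gamma,r}(v_0)|}\sum_{v\in\mathcal{H}_{\gamma,r}(v_0)}\tilde f(v)-\frac{1}{|V|}\sum_{v\in V}f(v)\Big|\le C_G\,\|f\|_2\,\beta_{\max}^{\,r}.$$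
   Context: A loop at a vertex contributes $2$ to its degree. The norm is $\|f\|_2=\langle f,f\rangle^{1/2}$ with $\langle f,g\rangle=\sum_{v\in V}f(v)g(v)$. Universal cover: $\widetilde G$ is the universal covering tree of $G$, with vertex set $\widetilde V$: fix a root vertex of $G$; the vertices of $\widetilde G$ are the non-backtracking paths in $G$ starting at the root, two being adjacent if they differ by exactly one edge at the end. The projection $\pi:\widetilde G\to G$ sends a path to its end vertex. The lift of $f$ is $\tilde f=f\circ\pi$. $\delta$ is the combinatorial distance. Spheres and arcs: for $x\in\widetilde V$, $S_r(x)=\{v\in\widetilde V:\delta(v,x)=r\}$. For a directed edge $a$ of $\widetilde G$ from $w'$ to $w$, $A_0(a)=\{w'\}$ and $A_{r+1}(a)=S_{r+1}(w')\cap S_r(w)$ for $r\ge 0$, and $M_{r,a}(f)=\frac{1}{|A_r(a)|}\sum_{x\in A_r(a)}\tilde f(x)$. For a directed edge $a$ of $G$, $M_{r,a}(f)$ is computed using any lift of $a$ to $\widetilde G$ (the value does not depend on the lift). Horocycles: a geodesic $\gamma$ in $\widetilde G$ is a bi-infinite non-backtracking path given by vertices $\ldots,v_{-1},v_0,v_1,\ldots\in\widetilde V$ with $v_i$ adjacent to $v_{i+1}$ and $v_i\ne v_{i+2}$ for all $i\in\mathbb{Z}$. The Busemann function is $b_{\gamma,v_k}(w)=\lim_{n\to\infty}\big(\delta(w,v_{k+n})-n\big)$; the horocycles are $H_k=b_{\gamma,v_0}^{-1}(k)$, $k\in\mathbb{Z}$; and $\mathcal{H}_{\gamma,r}(v_0)=H_0\cap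 S_r(v_r)$. The constant $C_G$ does not depend on $a$, $\gamma$, $f$, $r$; the rate $\beta_{\max}$ may depend on $G$ and $f$ but not on $a$, $\gamma$ or $r$. *)

theory Defs
  imports "HOL-Analysis.L2_Norm" "Graph_Theory.Graph_Theory"
begin

text \<open>
  An undirected multigraph is a \<^locale>\<open>bidirected_digraph\<close>: each undirected edge, loops included, is
  a pair of distinct arcs exchanged by the involution \<open>arev\<close>, and the directed edges are the arcs.
  A loop therefore gives two arcs leaving its vertex, so that \<^const>\<open>out_degree\<close> is the degree
  in which a loop counts twice.
\<close>

definition bipartite :: "('v, 'e) pre_digraph \<Rightarrow> bool" where
  "bipartite G \<longleftrightarrow> (\<exists>X Y. X \<union> Y = verts G \<and> X \<inter> Y = {} \<and>
     (\<forall>e\<in>arcs G. tail G e \<in> X \<and> head G e \<in> Y \<or> tail G e \<in> Y \<and> head G e \<in> X))"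

definition graph_dist :: "('v, 'e) pre_digraph \<Rightarrow> 'v \<Rightarrow> 'v \<Rightarrow> nat" where
  "graph_dist G u v = (LEAST n. \<exists>p. pre_digraph.awalk G u p v \<and> length p = n)"

definition average :: "('a \<Rightarrow> real) \<Rightarrow> 'a set \<Rightarrow> real" where
  "average f A = (\<Sum>x\<in>A. f x) / real (card A)"


subsection \<open>The universal cover\<close>

text \<open>
  Paths are lists of arcs, so parallel edges and the two orientations of a loop are distinguished;
  backtracking means following an arc immediately by its reverse.
\<close>

definition nb_paths :: "('v, 'e) pre_digraph \<Rightarrow> ('e \<Rightarrow> 'e) \<Rightarrow> 'v \<Rightarrow> 'e list set" where
  "nb_paths G arev x0 =
     {p. (\<exists>v. pre_digraph.awalk G x0 p v) \<and> successively (\<lambda>e e'. e' \<noteq> arev e) p}"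

definition univ_cover ::
    "('v, 'e) pre_digraph \<Rightarrow> ('e \<Rightarrow> 'e) \<Rightarrow> 'v \<Rightarrow> ('e list, 'e list \<times> 'e list) pre_digraph" where
  "univ_cover G arev x0 = with_proj
     \<lparr> pverts = nb_paths G arev x0,
       parcs = {(p, p'). p \<in> nb_paths G arev x0 \<and> p' \<in> nb_paths G arev x0 \<and>
                         (\<exists>e. p' = p @ [e] \<or> p = p' @ [e])} \<rparr>"

definition cover_proj :: "('v, 'e) pre_digraph \<Rightarrow> 'v \<Rightarrow> 'e list \<Rightarrow> 'v" where
  "cover_proj G x0 p = pre_digraph.awlast G x0 p"

definition lift_fun :: "('v, 'e) pre_digraph \<Rightarrow> 'v \<Rightarrow> ('v \<Rightarrow> real) \<Rightarrow> 'e list \<Rightarrow> real" where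
  "lift_fun G x0 f = f \<circ> cover_proj G x0"

text \<open>
  The directed edge from \<open>p\<close> to \<open>p @ [a]\<close> lies over \<open>a\<close>, and so the opposite one, from \<open>p @ [e]\<close>
  to \<open>p\<close>, lies over \<open>arev e\<close>.
\<close>

definition is_lift ::
    "('v, 'e) pre_digraph \<Rightarrow> ('e \<Rightarrow> 'e) \<Rightarrow> 'v \<Rightarrow> 'e \<Rightarrow> 'e list \<times> 'e list \<Rightarrow> bool" where
  "is_lift G arev x0 a b \<longleftrightarrow> b \<in> arcs (univ_cover G arev x0) \<and>
     (snd b = fst b @ [a] \<or> (\<exists>e. fst b = snd b @ [e] \<and> a = arev e))"


subsection \<open>Spheres and arcs\<close>

definition graph_sphere :: "('v, 'e) pre_digraph \<Rightarrow> nat \<Rightarrow> 'v \<Rightarrow> 'v set" where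
  "graph_sphere T r x = {v \<in> verts T. graph_dist T v x = r}"

fun arc_set :: "('v, 'e) pre_digraph \<Rightarrow> nat \<Rightarrow> 'e \<Rightarrow> 'v set" where
  "arc_set T 0 b = {tail T b}"
| "arc_set T (Suc r) b = graph_sphere T (Suc r) (tail T b) \<inter> graph_sphere T r (head T b)"


subsection \<open>Horocycles\<close>

definition geodesic :: "('v, 'e) pre_digraph \<Rightarrow> (int \<Rightarrow> 'v) \<Rightarrow> bool" where
  "geodesic T \<gamma> \<longleftrightarrow>
     (\<forall>i. \<gamma> i \<in> verts T \<and> \<gamma> i \<rightarrow>\<^bsub>T\<^esub> \<gamma> (i + 1) \<and> \<gamma> i \<noteq> \<gamma> (i + 2))"

text \<open>The base point \<open>\<gamma> k\<close> is given by its index \<open>k\<close>.\<close>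

definition busemann :: "('v, 'e) pre_digraph \<Rightarrow> (int \<Rightarrow> 'v) \<Rightarrow> int \<Rightarrow> 'v \<Rightarrow> real" where
  "busemann T \<gamma> k w = lim (\<lambda>n. real (graph_dist T w (\<gamma> (k + int n))) - real n)"

definition horocycle :: "('v, 'e) pre_digraph \<Rightarrow> (int \<Rightarrow> 'v) \<Rightarrow> int \<Rightarrow> 'v set" where
  "horocycle T \<gamma> k = {w \<in> verts T. busemann T \<gamma> 0 w = real_of_int k}"

definition horocycle_part :: "('v, 'e) pre_digraph \<Rightarrow> (int \<Rightarrow> 'v) \<Rightarrow> nat \<Rightarrow> 'v set" where
  "horocycle_part T \<gamma> r = horocycle T \<gamma> 0 \<inter> graph_sphere T r (\<gamma> (int r))"


subsection \<open>Every arc has a lift\<close>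

lemma nb_paths_snoc:
  assumes "bidirected_digraph G arev" and p: "pre_digraph.awalk G x0 p (tail G a)"
    and nb: "successively (\<lambda>e e'. e' \<noteq> arev e) p" and a: "a \<in> arcs G"
  shows "(p @ [a] \<in> nb_paths G arev x0 \<and> pre_digraph.awalk G x0 (p @ [a]) (head G a)) \<or>
         (\<exists>p' e. p = p' @ [e] \<and> a = arev e \<and> p' \<in> nb_paths G arev x0 \<and>
                 pre_digraph.awalk G x0 p' (head G a))"
proof -
  interpret bidirected_digraph G arev by fact
  show ?thesis
  proof (cases "p \<noteq> [] \<and> a = arev (last p)")
    case True
    then obtain p' e where [simp]: "p = p' @ [e]" by (metis append_butlast_last_id)
    have "a = arev e" using True by simp
    then have "awalk x0 p' (head G a)"
      using p a by (auto simp: awalk_simps)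
    then show ?thesis
      using \<open>a = arev e\<close> nb by (auto simp: nb_paths_def successively_append_iff)
  next
    case False
    have "awalk x0 (p @ [a]) (head G a)"
      using p a by (auto simp: awalk_simps)
    then show ?thesis
      using False nb by (auto simp: nb_paths_def successively_append_iff)
  qed
qed

lemma nb_path_exists:
  assumes bi: "bidirected_digraph G arev" and "pre_digraph.awalk G x0 p v"
  shows "\<exists>p' \<in> nb_paths G arev x0. pre_digraph.awalk G x0 p' v"
  using assms(2)
proof (induction p arbitrary: v rule: rev_induct)
  case Nil
  then show ?case by (auto simp: nb_paths_def intro!: bexI[of _ "[]"])
next
  case (snoc a p)
  interpret bidirected_digraph G arev by fact
  from snoc.prems have a: "a \<in> arcs G" "v = head G a" and "awalk x0 p (tail G a)"
    by (auto simp: awalk_Cons_iff)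
  then obtain p' where "p' \<in> nb_paths G arev x0" "awalk x0 p' (tail G a)"
    using snoc.IH by blast
  then show ?case
    using nb_paths_snoc[OF bi, of x0 p' a] a by (auto simp: nb_paths_def)
qed

lemma lift_exists:
  assumes bi: "bidirected_digraph G arev" and conn: "Digraph_Component.connected G"
    and x0: "x0 \<in> verts G" and a: "a \<in> arcs G"
  shows "\<exists>b. is_lift G arev x0 a b"
proof -
  interpret bidirected_digraph G arev by fact
  have "x0 \<rightarrow>\<^sup>*\<^bsub>G\<^esub> tail G a"
    using conn x0 a
    by (simp add: connected_def strongly_connected_def sym_arcs reachable_mk_symmetric_eq)
  then obtain p where "awalk x0 p (tail G a)" by (auto simp: reachable_awalk)
  then obtain p where p: "p \<in> nb_paths G arev x0" "awalk x0 p (tail G a)"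
    using nb_path_exists[OF bi] by blast
  then have nb: "successively (\<lambda>e e'. e' \<noteq> arev e) p" by (simp add: nb_paths_def)
  from nb_paths_snoc[OF bi p(2) nb a] show ?thesis
  proof (elim disjE exE conjE)
    assume "p @ [a] \<in> nb_paths G arev x0"
    then have "is_lift G arev x0 a (p, p @ [a])" using p by (simp add: is_lift_def univ_cover_def)
    then show ?thesis ..
  next
    fix p' e assume "p = p' @ [e]" "a = arev e" "p' \<in> nb_paths G arev x0"
    then have "is_lift G arev x0 a (p, p')" using p by (simp add: is_lift_def univ_cover_def)
    then show ?thesis ..
  qed
qed

end

theory Submission
  imports Defs "HOL-Library.Sublist"
begin

text \<open>
  An average over a tree arc is a value of a finite Markov chain. In the tree, the points of
  \<open>A\<^sub>r\<^sub>+\<^sub>1(a)\<close> are the end points of the \<open>q\<^sup>r\<close> non-backtracking walks that start by traversing \<open>a\<close> and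
  then make \<open>r\<close> more steps. Projecting to \<open>G\<close>, the average of the lift of \<open>f\<close> over \<open>A\<^sub>r\<^sub>+\<^sub>1(a)\<close> is
  \<open>P\<^sup>r g\<close> at \<open>a\<close>, where \<open>g\<close> is \<open>f\<close> at the head of an arc and \<open>P\<close> is the operator of the
  non-backtracking walk on the arcs of \<open>G\<close>: it averages over the \<open>q\<close> arcs that may follow a given
  one (\<open>average_arc_set\<close>).

  Reversing arcs shows that every arc also has exactly \<open>q\<close> predecessors, so the uniform distribution
  is stationary for this chain. The chain is moreover primitive: for some \<open>N\<close>, every arc can be
  reached from every arc in exactly \<open>N\<close> steps (\<open>nb_walk_primitive\<close>). The number of arcs reached
  in \<open>n\<close> steps from a given arc does not decrease with \<open>n\<close>, so it stops growing, and the sets reached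
  from then on are unions of full stars, both of outgoing and of incoming arcs. The tails and the
  heads of such a set are adjacent only to each other, so that each of them is the whole vertex set
  of a connected nonbipartite graph.

  Doeblin's argument turns primitivity into a rate. If \<open>g\<close> takes values in an interval, then
  \<open>P\<^sup>N g\<close> takes values in an interval shorter by the factor \<open>1 - q\<^sup>-\<^sup>N\<close>, because every value of
  \<open>P\<^sup>N g\<close> gives weight at least \<open>q\<^sup>-\<^sup>N\<close> to one and the same arc. The mean over all arcs is
  preserved and stays in these intervals, which shrink exponentially (\<open>nb_avg_mixing\<close>). The rate
  \<open>max ((1 - q\<^sup>-\<^sup>N)\<^sup>1\<^sup>/\<^sup>N) (q\<^sup>-\<^sup>1\<^sup>/\<^sup>2)\<close> obtained in this way serves all \<open>f\<close> at once.

  The part of the horocycle at distance \<open>r\<close> from \<open>v\<^sub>r\<close> is itself a tree arc: it is \<open>A\<^sub>r\<^sub>+\<^sub>1\<close> of the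
  edge from \<open>v\<^sub>r\<^sub>+\<^sub>1\<close> to \<open>v\<^sub>r\<close> (\<open>horocycle_part_eq_arc_set\<close>), since a point at distance \<open>r\<close> from \<open>v\<^sub>r\<close> lies on
  the horocycle through \<open>v\<^sub>0\<close> exactly if the geodesic ray from \<open>v\<^sub>r\<close> leads away from it at once. So
  the second estimate is an instance of the first one.
\<close>

lemma average_in_interval:
  assumes "finite A" "A \<noteq> {}" and g: "\<And>a. a \<in> A \<Longrightarrow> g a \<in> {m..M}"
  shows "average g A \<in> {m..M}"
proof -
  have "real (card A) * m \<le> sum g A" "sum g A \<le> real (card A) * M"
    using g by (auto intro!: sum_bounded_above sum_bounded_below)
  then show ?thesis
    using assms(1,2) by (simp add: average_def field_simps card_gt_0_iff)
qed

lemma abs_le_L2_set: "finite A \<Longrightarrow> v \<in> A \<Longrightarrow> \<bar>f v\<bar> \<le> L2_set f A"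
  using member_le_L2_set[of A v "\<lambda>v. \<bar>f v\<bar>"] by (simp add: L2_set_def)


section \<open>The non-backtracking walk is primitive\<close>

locale regular_multigraph = fin_digraph G + bidirected_digraph G arev
  for G :: "('v, 'e) pre_digraph" and arev :: "'e \<Rightarrow> 'e" +
  fixes q :: nat
  assumes regular: "v \<in> verts G \<Longrightarrow> out_degree G v = q + 1"
    and q_ge_2: "q \<ge> 2"
begin

definition nb_succ :: "'e \<Rightarrow> 'e set" where
  "nb_succ a = out_arcs G (head G a) - {arev a}"

definition nb_pred :: "'e \<Rightarrow> 'e set" where
  "nb_pred b = in_arcs G (tail G b) - {arev b}"

lemma in_nb_succ: "b \<in> nb_succ a \<longleftrightarrow> b \<in> arcs G \<and> tail G b = head G a \<and> b \<noteq> arev a"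
  by (auto simp: nb_succ_def)

lemma nb_succ_arcs: "nb_succ a \<subseteq> arcs G"
  by (auto simp: in_nb_succ)

lemma finite_nb_succ [simp]: "finite (nb_succ a)"
  by (rule finite_subset[OF nb_succ_arcs]) simp

lemma finite_nb_pred [simp]: "finite (nb_pred b)"
  by (rule finite_subset[of _ "arcs G"]) (auto simp: nb_pred_def)

lemma nb_pred_iff: "a \<in> nb_pred b \<longleftrightarrow> a \<in> arcs G \<and> b \<in> nb_succ a" if "b \<in> arcs G"
  using that by (auto simp: nb_pred_def nb_succ_def)

lemma card_out_arcs: "v \<in> verts G \<Longrightarrow> card (out_arcs G v) = q + 1"
  using regular by (simp add: out_degree_def)

lemma card_in_arcs: "v \<in> verts G \<Longrightarrow> card (in_arcs G v) = q + 1"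
  by (simp add: in_arcs_eq card_image card_out_arcs inj_on_arev)

lemma card_nb_succ: "a \<in> arcs G \<Longrightarrow> card (nb_succ a) = q"
  by (simp add: nb_succ_def card_out_arcs)

lemma card_nb_pred: "b \<in> arcs G \<Longrightarrow> card (nb_pred b) = q"
  by (simp add: nb_pred_def card_in_arcs)

definition nb_image :: "'e set \<Rightarrow> 'e set" where
  "nb_image A = (\<Union>a\<in>A. nb_succ a)"

lemma nb_image_arcs: "nb_image A \<subseteq> arcs G"
  by (auto simp: nb_image_def in_nb_succ)

text \<open>
  Both sides count the pairs of an arc of \<open>A\<close> and a successor of it. As every arc has \<open>q\<close>
  successors and at most \<open>q\<close> predecessors in \<open>A\<close>, passing to the successors cannot shrink \<open>A\<close>, and it
  keeps the size only if all predecessors of the image lie in \<open>A\<close>.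
\<close>

lemma nb_image_count:
  assumes "A \<subseteq> arcs G"
  shows "(\<Sum>b\<in>nb_image A. card (nb_pred b \<inter> A)) = q * card A"
proof -
  have fin: "finite A" "finite (nb_image A)"
    using assms by (auto intro: finite_subset[OF nb_image_arcs] finite_subset[of A])
  have "(\<Sum>a\<in>A. card {b \<in> nb_image A. b \<in> nb_succ a}) = (\<Sum>b\<in>nb_image A. card (nb_pred b \<inter> A))"
  proof (rule sum_multicount_gen[OF fin], intro ballI arg_cong[where f = card])
    fix b assume "b \<in> nb_image A"
    then have "b \<in> arcs G" using nb_image_arcs by auto
    then show "{a \<in> A. b \<in> nb_succ a} = nb_pred b \<inter> A"
      using nb_pred_iff assms by auto
  qed
  moreover have "card {b \<in> nb_image A. b \<in> nb_succ a} = q" if "a \<in> A" for a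
  proof -
    have "{b \<in> nb_image A. b \<in> nb_succ a} = nb_succ a" using that by (auto simp: nb_image_def)
    then show ?thesis using that assms card_nb_succ by auto
  qed
  ultimately show ?thesis by (simp add: mult.commute)
qed

lemma card_nb_pred_inter: "b \<in> arcs G \<Longrightarrow> card (nb_pred b \<inter> A) \<le> q"
  using card_mono[of "nb_pred b" "nb_pred b \<inter> A"] by (simp add: card_nb_pred)

lemma card_le_card_nb_image:
  assumes "A \<subseteq> arcs G" shows "card A \<le> card (nb_image A)"
proof -
  have "q * card A \<le> (\<Sum>b\<in>nb_image A. q)"
    unfolding nb_image_count[OF assms, symmetric]
    using nb_image_arcs by (intro sum_mono card_nb_pred_inter) auto
  then show ?thesis using q_ge_2 by simp
qed

lemma nb_pred_subset:
  assumes A: "A \<subseteq> arcs G" and eq: "card (nb_image A) = card A" and b: "b \<in> nb_image A"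
  shows "nb_pred b \<subseteq> A"
proof (rule ccontr)
  assume "\<not> nb_pred b \<subseteq> A"
  have bG: "b \<in> arcs G" using b nb_image_arcs by auto
  have "card (nb_pred b \<inter> A) < card (nb_pred b)"
    using \<open>\<not> nb_pred b \<subseteq> A\<close> by (intro psubset_card_mono) (auto simp: nb_pred_def)
  then have "card (nb_pred b \<inter> A) < q" using bG by (simp add: card_nb_pred)
  then have "(\<Sum>b\<in>nb_image A. card (nb_pred b \<inter> A)) < (\<Sum>b\<in>nb_image A. q)"
    using nb_image_arcs b card_nb_pred_inter
    by (intro sum_strict_mono_ex1) (auto intro: finite_subset[OF nb_image_arcs])
  then show False using eq nb_image_count[OF A] by simp
qed

text \<open>
  With at least two ways to continue or to arrive, the exclusion of backtracking at a vertex can be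
  bypassed by taking a second neighbouring arc. The star lemmas below rest on this.
\<close>

lemma exists_nb_pred_avoiding:
  assumes "b \<in> arcs G" shows "\<exists>a \<in> nb_pred b. a \<noteq> c"
proof (rule ccontr)
  assume "\<not> ?thesis"
  then have "nb_pred b \<subseteq> {c}" by auto
  then have "card (nb_pred b) \<le> 1" using card_mono[of "{c}"] by force
  then show False using card_nb_pred[OF assms] q_ge_2 by simp
qed

lemma exists_nb_succ_avoiding:
  assumes "a \<in> arcs G" shows "\<exists>b \<in> nb_succ a. b \<noteq> c"
proof (rule ccontr)
  assume "\<not> ?thesis"
  then have "nb_succ a \<subseteq> {c}" by auto
  then have "card (nb_succ a) \<le> 1" using card_mono[of "{c}"] by force
  then show False using card_nb_succ[OF assms] q_ge_2 by simp
qed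

text \<open>
  Suppose that \<open>A\<close> has as many successors as elements, and let \<open>b\<close> and \<open>c\<close> leave the same vertex. A
  predecessor \<open>a\<close> of \<open>b\<close> other than the reverse of \<open>c\<close> lies in \<open>A\<close>, and \<open>c\<close> is a successor of \<open>a\<close>.
\<close>

lemma out_star_of_stable:
  assumes A: "A \<subseteq> arcs G" and eq: "card (nb_image A) = card A" and b: "b \<in> nb_image A"
  shows "out_arcs G (tail G b) \<subseteq> nb_image A"
proof
  fix c assume c: "c \<in> out_arcs G (tail G b)"
  have bG: "b \<in> arcs G" using b nb_image_arcs by auto
  obtain a where a: "a \<in> nb_pred b" "a \<noteq> arev c" using exists_nb_pred_avoiding[OF bG] by auto
  then have "a \<in> A" using nb_pred_subset[OF A eq b] by auto
  moreover have "c \<in> nb_succ a" using a c by (auto simp: nb_pred_def in_nb_succ)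
  ultimately show "c \<in> nb_image A" by (auto simp: nb_image_def)
qed

text \<open>
  The same argument read backwards: a common successor of \<open>a\<close> and \<open>c\<close> brings \<open>c\<close> into \<open>A\<close>.
\<close>

lemma in_star_of_stable:
  assumes A: "A \<subseteq> arcs G" and eq: "card (nb_image A) = card A" and a: "a \<in> A"
  shows "in_arcs G (head G a) \<subseteq> A"
proof
  fix c assume c: "c \<in> in_arcs G (head G a)"
  obtain b where b: "b \<in> nb_succ a" "b \<noteq> arev c"
    using exists_nb_succ_avoiding a A by (metis subsetD)
  then have "b \<in> nb_image A" using a by (auto simp: nb_image_def)
  then have "nb_pred b \<subseteq> A" using nb_pred_subset[OF A eq] by auto
  moreover have "c \<in> nb_pred b" using b c by (auto simp: nb_pred_def in_nb_succ)
  ultimately show "c \<in> A" by auto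
qed

lemma connected_closed_subset:
  assumes conn: "Digraph_Component.connected G"
    and S: "S \<inter> verts G \<noteq> {}" and closed: "\<And>e. e \<in> arcs G \<Longrightarrow> tail G e \<in> S \<Longrightarrow> head G e \<in> S"
  shows "verts G \<subseteq> S"
proof
  fix v assume v: "v \<in> verts G"
  obtain u where u: "u \<in> S" "u \<in> verts G" using S by auto
  have "u \<rightarrow>\<^sup>*\<^bsub>G\<^esub> v"
    using conn u v
    by (simp add: connected_def strongly_connected_def sym_arcs reachable_mk_symmetric_eq)
  then obtain p where "awalk u p v" by (auto simp: reachable_awalk)
  then show "v \<in> S" using u(1)
    by (induction p arbitrary: u) (auto simp: awalk_Cons_iff closed)
qed

text \<open>
  Let \<open>X\<close> be the set of tails and \<open>Y\<close> the set of heads of the arcs of \<open>A\<close>. Since stars are full, every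
  edge leads from \<open>X\<close> into \<open>Y\<close> and from \<open>Y\<close> into \<open>X\<close>. Hence both \<open>X \<union> Y\<close> and \<open>X \<inter> Y\<close> are closed
  under adjacency; the former is everything, and the latter is nonempty because \<open>G\<close> is not bipartite.
\<close>

lemma stars_closed_eq_arcs:
  assumes conn: "Digraph_Component.connected G" and nonbip: "\<not> bipartite G"
    and A: "A \<subseteq> arcs G" "A \<noteq> {}"
    and out: "\<And>a. a \<in> A \<Longrightarrow> out_arcs G (tail G a) \<subseteq> A"
    and inn: "\<And>a. a \<in> A \<Longrightarrow> in_arcs G (head G a) \<subseteq> A"
  shows "A = arcs G"
proof -
  define X Y where "X = tail G ` A" and "Y = head G ` A"
  have sub: "X \<subseteq> verts G" "Y \<subseteq> verts G" using A by (auto simp: X_def Y_def)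
  have XY: "head G e \<in> Y" if "e \<in> arcs G" "tail G e \<in> X" for e
    using that out by (force simp: X_def Y_def)
  have YX: "head G e \<in> X" if e: "e \<in> arcs G" "tail G e \<in> Y" for e
  proof -
    obtain a where a: "a \<in> A" "head G a = tail G e" using e by (auto simp: Y_def)
    have "arev e \<in> A" using inn[OF a(1)] a(2) e(1) by auto
    then show ?thesis using tail_arev[OF e(1)] unfolding X_def by (metis image_eqI)
  qed
  have "(X \<union> Y) \<inter> verts G \<noteq> {}" using A(2) sub unfolding X_def by blast
  then have "verts G \<subseteq> X \<union> Y"
    using XY YX by (intro connected_closed_subset[OF conn]) auto
  have "X \<inter> Y \<noteq> {}"
  proof
    assume disj: "X \<inter> Y = {}"
    have "tail G e \<in> X \<and> head G e \<in> Y \<or> tail G e \<in> Y \<and> head G e \<in> X" if "e \<in> arcs G" for e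
      using XY[OF that] YX[OF that] \<open>verts G \<subseteq> X \<union> Y\<close> tail_in_verts[OF that] by blast
    moreover have "X \<union> Y = verts G" using \<open>verts G \<subseteq> X \<union> Y\<close> sub by blast
    ultimately show False using nonbip disj unfolding bipartite_def by blast
  qed
  then have "(X \<inter> Y) \<inter> verts G \<noteq> {}" using sub by blast
  then have "verts G \<subseteq> X \<inter> Y"
    using XY YX by (intro connected_closed_subset[OF conn]) auto
  then have tail: "tail G e \<in> X" if "e \<in> arcs G" for e
    using tail_in_verts[OF that] by blast
  have "e \<in> A" if e: "e \<in> arcs G" for e
  proof -
    obtain a where a: "a \<in> A" "tail G e = tail G a" using tail[OF e] unfolding X_def by blast
    then have "e \<in> out_arcs G (tail G a)" using e by simp
    then show ?thesis using out[OF a(1)] by blast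
  qed
  then show ?thesis using A(1) by blast
qed

text \<open>
  The arcs at which a non-backtracking walk from \<open>a\<close> can be after exactly \<open>n\<close> steps.
\<close>

definition nb_reach :: "nat \<Rightarrow> 'e \<Rightarrow> 'e set" where
  "nb_reach n a = (nb_image ^^ n) {a}"

lemma nb_reach_0 [simp]: "nb_reach 0 a = {a}"
  and nb_reach_Suc: "nb_reach (Suc n) a = nb_image (nb_reach n a)"
  by (simp_all add: nb_reach_def)

lemma nb_image_Union: "nb_image (\<Union>i\<in>I. A i) = (\<Union>i\<in>I. nb_image (A i))"
  by (auto simp: nb_image_def)

lemma nb_reach_Suc': "nb_reach (Suc n) a = (\<Union>b\<in>nb_succ a. nb_reach n b)"
proof (induction n)
  case 0 show ?case by (auto simp: nb_reach_Suc nb_image_def)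
next
  case (Suc n)
  have "nb_reach (Suc (Suc n)) a = nb_image (nb_reach (Suc n) a)" by (rule nb_reach_Suc)
  also have "\<dots> = (\<Union>b\<in>nb_succ a. nb_reach (Suc n) b)"
    unfolding Suc.IH nb_image_Union by (simp add: nb_reach_Suc)
  finally show ?case .
qed

lemma nb_reach_arcs: "a \<in> arcs G \<Longrightarrow> nb_reach n a \<subseteq> arcs G"
  using nb_image_arcs by (cases n) (auto simp: nb_reach_Suc)

lemma nb_image_all: "nb_image (arcs G) = arcs G"
proof -
  have "card (arcs G) \<le> card (nb_image (arcs G))" by (rule card_le_card_nb_image) simp
  then show ?thesis using nb_image_arcs card_seteq[of "arcs G"] by auto
qed

lemma nb_reach_all_mono:
  assumes "nb_reach n a = arcs G" "n \<le> m" shows "nb_reach m a = arcs G"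
  using assms(2,1) by (induction m rule: dec_induct) (auto simp: nb_reach_Suc nb_image_all)

text \<open>
  The sizes of the reachable sets increase and are bounded, so three consecutive ones agree at some
  time. The middle set is then the image of a set of the same size, hence contains full outgoing stars,
  and has an image of the same size, hence contains full incoming stars.
\<close>

lemma nb_reach_eventually_all:
  assumes conn: "Digraph_Component.connected G" and nonbip: "\<not> bipartite G" and a: "a \<in> arcs G"
  shows "\<exists>n. nb_reach n a = arcs G"
proof -
  define s where "s n = card (nb_reach n a)" for n
  have "s n \<le> s (Suc n)" for n
    unfolding s_def nb_reach_Suc by (rule card_le_card_nb_image[OF nb_reach_arcs[OF a]])
  then have "mono s" by (simp add: mono_iff_le_Suc)
  have bound: "s n \<le> card (arcs G)" for n
    unfolding s_def using nb_reach_arcs[OF a] by (intro card_mono) auto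
  have "\<exists>n. s (Suc (Suc n)) \<le> s n"
  proof (rule ccontr)
    assume "\<not> ?thesis"
    then have up: "s n < s (Suc (Suc n))" for n by (meson not_le)
    \<comment> \<open>Otherwise the sizes would gain at least one in every two steps.\<close>
    have "n \<le> s (2 * n)" for n
    proof (induction n)
      case (Suc n)
      then show ?case using up[of "2 * n"] by simp
    qed simp
    then show False using bound by (meson Suc_n_not_le_n order_trans)
  qed
  then obtain n where n: "s (Suc (Suc n)) \<le> s n" ..
  let ?A = "nb_reach n a" and ?B = "nb_reach (Suc n) a"
  have eqs: "card (nb_image ?A) = card ?A" "card (nb_image ?B) = card ?B"
    using n monoD[OF \<open>mono s\<close>, of n "Suc n"] monoD[OF \<open>mono s\<close>, of "Suc n" "Suc (Suc n)"]
    by (auto simp: s_def nb_reach_Suc)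
  have AB: "?A \<subseteq> arcs G" "?B \<subseteq> arcs G" by (rule nb_reach_arcs[OF a])+
  have "s 0 \<le> s (Suc n)" by (rule monoD[OF \<open>mono s\<close>]) simp
  then have ne: "?B \<noteq> {}" by (auto simp: s_def)
  have "?B = arcs G"
  proof (rule stars_closed_eq_arcs[OF conn nonbip AB(2) ne])
    show "out_arcs G (tail G b) \<subseteq> ?B" if "b \<in> ?B" for b
      using out_star_of_stable[OF AB(1) eqs(1)] that unfolding nb_reach_Suc .
    show "in_arcs G (head G b) \<subseteq> ?B" if "b \<in> ?B" for b
      using in_star_of_stable[OF AB(2) eqs(2)] that .
  qed
  then show ?thesis ..
qed

lemma nb_walk_primitive:
  assumes conn: "Digraph_Component.connected G" and nonbip: "\<not> bipartite G"
  obtains N where "N > 0" "\<And>a. a \<in> arcs G \<Longrightarrow> nb_reach N a = arcs G"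
proof -
  obtain n where n: "\<And>a. a \<in> arcs G \<Longrightarrow> nb_reach (n a) a = arcs G"
    using nb_reach_eventually_all[OF conn nonbip] by metis
  define N where "N = Suc (Max (n ` arcs G))"
  have "nb_reach N a = arcs G" if "a \<in> arcs G" for a
    using that by (intro nb_reach_all_mono[OF n]) (auto simp: N_def intro!: le_SucI)
  then show thesis using that[of N] by (simp add: N_def)
qed


section \<open>Mixing of the non-backtracking walk\<close>

definition nb_avg :: "('e \<Rightarrow> real) \<Rightarrow> 'e \<Rightarrow> real" where
  "nb_avg g a = (\<Sum>b\<in>nb_succ a. g b) / real q"

lemma nb_avg_uminus: "nb_avg (\<lambda>b. - g b) = (\<lambda>a. - nb_avg g a)"
  by (simp add: nb_avg_def sum_negf fun_eq_iff)

lemma nb_avg_funpow_uminus: "(nb_avg ^^ n) (\<lambda>b. - g b) = (\<lambda>a. - (nb_avg ^^ n) g a)"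
  by (induction n) (simp_all add: nb_avg_uminus)

lemma nb_avg_ge:
  assumes m: "\<And>b. b \<in> arcs G \<Longrightarrow> m \<le> g b" and a: "a \<in> arcs G"
  shows "m \<le> nb_avg g a"
proof -
  have "real q * m = (\<Sum>b\<in>nb_succ a. m)" using a by (simp add: card_nb_succ)
  also have "\<dots> \<le> (\<Sum>b\<in>nb_succ a. g b)" by (intro sum_mono m) (simp add: in_nb_succ)
  finally show ?thesis using q_ge_2 by (simp add: nb_avg_def field_simps)
qed

lemma nb_avg_funpow_ge:
  assumes m: "\<And>b. b \<in> arcs G \<Longrightarrow> m \<le> g b" and a: "a \<in> arcs G"
  shows "m \<le> (nb_avg ^^ n) g a"
  using a by (induction n arbitrary: a) (auto simp: m intro!: nb_avg_ge)

text \<open>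
  A walk of \<open>n\<close> steps from \<open>a\<close> to \<open>c\<close> has probability at least \<open>q\<^sup>-\<^sup>n\<close>, so an excess of \<open>g\<close> over its
  lower bound at \<open>c\<close> contributes at least this proportion to the average.
\<close>

lemma nb_avg_funpow_ge_reach:
  assumes m: "\<And>b. b \<in> arcs G \<Longrightarrow> m \<le> g b" and a: "a \<in> arcs G" and c: "c \<in> nb_reach n a"
  shows "m + (g c - m) / real q ^ n \<le> (nb_avg ^^ n) g a"
  using a c
proof (induction n arbitrary: a)
  case (Suc n)
  let ?h = "(nb_avg ^^ n) g"
  obtain b where b: "b \<in> nb_succ a" "c \<in> nb_reach n b" using Suc.prems by (auto simp: nb_reach_Suc')
  have "real q * m + (g c - m) / real q ^ n = (m + (g c - m) / real q ^ n) + (\<Sum>x\<in>nb_succ a - {b}. m)"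
    using b Suc.prems q_ge_2 by (simp add: card_nb_succ of_nat_diff algebra_simps)
  also have "\<dots> \<le> ?h b + (\<Sum>x\<in>nb_succ a - {b}. ?h x)"
    using b nb_succ_arcs[of a] by (intro add_mono Suc.IH sum_mono nb_avg_funpow_ge m) auto
  also have "\<dots> = (\<Sum>x\<in>nb_succ a. ?h x)" using b by (simp add: sum.remove)
  finally have "(real q * m + (g c - m) / real q ^ n) / real q \<le> nb_avg ?h a"
    unfolding nb_avg_def by (rule divide_right_mono) simp
  then show ?case using q_ge_2 by (simp add: add_divide_distrib mult.commute)
qed simp

text \<open>
  The value of \<open>g\<close> at one fixed arc \<open>c\<close> enters all averages with weight at least \<open>q\<^sup>-\<^sup>N\<close>. Both end
  points of the interval move towards that value, and the total gain is the same whatever it is.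
\<close>

lemma nb_avg_contracts:
  assumes reach: "\<And>a. a \<in> arcs G \<Longrightarrow> nb_reach N a = arcs G" and c: "c \<in> arcs G"
    and g: "\<And>a. a \<in> arcs G \<Longrightarrow> g a \<in> {m..M}"
  shows "\<exists>m' M'. M' - m' = (1 - 1 / real q ^ N) * (M - m) \<and>
                 (\<forall>a\<in>arcs G. (nb_avg ^^ N) g a \<in> {m'..M'})"
proof (intro exI conjI ballI)
  let ?m' = "m + (g c - m) / real q ^ N" and ?M' = "M + (g c - M) / real q ^ N"
  show "?M' - ?m' = (1 - 1 / real q ^ N) * (M - m)"
    using q_ge_2 by (simp add: field_simps)
  fix a assume a: "a \<in> arcs G"
  have "?m' \<le> (nb_avg ^^ N) g a"
    using g c by (intro nb_avg_funpow_ge_reach) (auto simp: a reach)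
  \<comment> \<open>The upper bound is the lower bound for the negative of the function.\<close>
  moreover have "- M + (- g c - (- M)) / real q ^ N \<le> (nb_avg ^^ N) (\<lambda>b. - g b) a"
    using g c by (intro nb_avg_funpow_ge_reach[where g = "\<lambda>b. - g b"]) (auto simp: a reach)
  then have "(nb_avg ^^ N) g a \<le> ?M'"
    by (simp add: nb_avg_funpow_uminus diff_divide_distrib)
  ultimately show "(nb_avg ^^ N) g a \<in> {?m'..?M'}" by simp
qed

lemma nb_avg_contracts_iterated:
  assumes reach: "\<And>a. a \<in> arcs G \<Longrightarrow> nb_reach N a = arcs G" and c: "c \<in> arcs G"
    and g: "\<And>a. a \<in> arcs G \<Longrightarrow> g a \<in> {m..M}"
  shows "\<exists>m' M'. M' - m' = (1 - 1 / real q ^ N) ^ k * (M - m) \<and>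
                 (\<forall>a\<in>arcs G. (nb_avg ^^ (k * N)) g a \<in> {m'..M'})"
proof (induction k)
  case 0
  show ?case using g by auto
next
  case (Suc k)
  then obtain m' M' where IH: "M' - m' = (1 - 1 / real q ^ N) ^ k * (M - m)"
    "\<And>a. a \<in> arcs G \<Longrightarrow> (nb_avg ^^ (k * N)) g a \<in> {m'..M'}" by blast
  from nb_avg_contracts[OF reach c IH(2)] show ?case
    by (simp add: IH(1) funpow_add mult.assoc)
qed

text \<open>
  The uniform distribution is stationary because every arc has exactly \<open>q\<close> predecessors.
\<close>

lemma sum_nb_avg: "(\<Sum>a\<in>arcs G. nb_avg g a) = (\<Sum>a\<in>arcs G. g a)"
proof -
  have "(\<Sum>a\<in>arcs G. \<Sum>b\<in>nb_succ a. g b) = (\<Sum>a\<in>arcs G. \<Sum>b\<in>{b \<in> arcs G. b \<in> nb_succ a}. g b)"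
    using nb_succ_arcs by (intro sum.cong) auto
  also have "\<dots> = (\<Sum>b\<in>arcs G. \<Sum>a\<in>{a \<in> arcs G. b \<in> nb_succ a}. g b)"
    by (rule sum.swap_restrict) auto
  also have "\<dots> = (\<Sum>b\<in>arcs G. real q * g b)"
  proof (rule sum.cong)
    fix b assume b: "b \<in> arcs G"
    have "{a \<in> arcs G. b \<in> nb_succ a} = nb_pred b" using nb_pred_iff[OF b] by blast
    then show "(\<Sum>a\<in>{a \<in> arcs G. b \<in> nb_succ a}. g b) = real q * g b"
      using b by (simp add: card_nb_pred)
  qed simp
  also have "\<dots> = real q * (\<Sum>b\<in>arcs G. g b)" by (simp add: sum_distrib_left)
  finally show ?thesis
    using q_ge_2 by (simp add: nb_avg_def flip: sum_divide_distrib)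
qed

lemma average_nb_avg_funpow: "average ((nb_avg ^^ n) g) (arcs G) = average g (arcs G)"
  by (induction n) (simp_all add: average_def sum_nb_avg)

text \<open>
  Split \<open>r\<close> into \<open>r div N\<close> blocks of length \<open>N\<close>, each of which contracts, and a remainder, which does
  not expand. The remainder costs the constant factor \<open>\<beta>\<^sup>-\<^sup>N\<close>.
\<close>

lemma nb_avg_mixing:
  assumes reach: "\<And>a. a \<in> arcs G \<Longrightarrow> nb_reach N a = arcs G" and N: "N > 0"
    and \<beta>: "0 < \<beta>" "\<beta> \<le> 1" "1 - 1 / real q ^ N \<le> \<beta> ^ N"
    and g: "\<And>a. a \<in> arcs G \<Longrightarrow> g a \<in> {m..M}" and a: "a \<in> arcs G"
  shows "\<bar>(nb_avg ^^ r) g a - average g (arcs G)\<bar> \<le> (M - m) * (\<beta> ^ r / \<beta> ^ N)"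
proof -
  define k s where "k = r div N" and "s = r mod N"
  have r: "r = k * N + s" by (simp add: k_def s_def)
  have s: "s \<le> N" using N by (simp add: s_def less_imp_le)
  have mM: "m \<le> M" using g[OF a] by simp
  have "(nb_avg ^^ s) g b \<in> {m..M}" if b: "b \<in> arcs G" for b
  proof -
    have "- M \<le> (nb_avg ^^ s) (\<lambda>b. - g b) b" using g b by (intro nb_avg_funpow_ge) auto
    then show ?thesis using g b nb_avg_funpow_ge[of m g b s] by (simp add: nb_avg_funpow_uminus)
  qed
  from nb_avg_contracts_iterated[where g = "(nb_avg ^^ s) g", OF reach a this, of k]
  obtain m' M' where m'M': "M' - m' = (1 - 1 / real q ^ N) ^ k * (M - m)"
    "\<And>b. b \<in> arcs G \<Longrightarrow> (nb_avg ^^ r) g b \<in> {m'..M'}" by (auto simp: r funpow_add)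
  have "average ((nb_avg ^^ r) g) (arcs G) \<in> {m'..M'}"
    using m'M'(2) a by (intro average_in_interval) auto
  then have "\<bar>(nb_avg ^^ r) g a - average g (arcs G)\<bar> \<le> M' - m'"
    using m'M'(2)[OF a] by (simp add: average_nb_avg_funpow abs_le_iff)
  also have "\<dots> \<le> (\<beta> ^ N) ^ k * (M - m)"
    unfolding m'M'(1) using \<beta> mM q_ge_2 by (intro mult_right_mono power_mono) auto
  also have "(\<beta> ^ N) ^ k \<le> \<beta> ^ r / \<beta> ^ N"
  proof -
    have "\<beta> ^ N \<le> \<beta> ^ s" using \<beta> s by (intro power_decreasing) auto
    then have "(\<beta> ^ N) ^ k * \<beta> ^ N \<le> \<beta> ^ r"
      using \<beta> by (simp add: r power_add power_mult mult.commute[of k] mult_left_mono)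
    then show ?thesis using \<beta> by (simp add: pos_le_divide_eq)
  qed
  finally show ?thesis using mM by (simp add: mult_right_mono mult.commute[of "M - m"])
qed

text \<open>
  Every vertex is the head of the same number \<open>q + 1\<close> of arcs.
\<close>

lemma average_head:
  assumes "verts G \<noteq> {}"
  shows "average (\<lambda>a. f (head G a)) (arcs G) = average f (verts G)"
proof -
  have "sum g (arcs G) = (\<Sum>v\<in>verts G. \<Sum>a\<in>in_arcs G v. g a)" for g :: "'e \<Rightarrow> real"
    unfolding in_arcs_def by (rule sum.group[symmetric]) auto
  then have *: "(\<Sum>a\<in>arcs G. f (head G a)) = (\<Sum>v\<in>verts G. real (q + 1) * f v)" for f :: "'v \<Rightarrow> real"
    by (auto simp: card_in_arcs intro!: sum.cong)
  have "real (card (arcs G)) = real (q + 1) * real (card (verts G))"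
    using *[of "\<lambda>_. 1"] by simp
  then show ?thesis
    unfolding average_def * by (simp del: of_nat_add flip: sum_distrib_left)
qed

end


section \<open>The metric of the universal cover\<close>

text \<open>
  The distance between two words in the tree of all words, in which a word is adjacent to its
  one-letter extensions: the number of letters outside the longest common prefix. The universal
  cover is a subtree of such a tree, so this is also its metric.
\<close>

fun tree_dist :: "'a list \<Rightarrow> 'a list \<Rightarrow> nat" where
  "tree_dist [] w = length w"
| "tree_dist (a # x) [] = Suc (length x)"
| "tree_dist (a # x) (b # w) = (if a = b then tree_dist x w else length x + length w + 2)"

lemma tree_dist_eq_0 [simp]: "tree_dist x w = 0 \<longleftrightarrow> x = w"
  by (induction x w rule: tree_dist.induct) auto

lemma tree_dist_self [simp]: "tree_dist x x = 0"
  by simp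

lemma tree_dist_Nil [simp]: "tree_dist x [] = length x"
  by (cases x) auto

text \<open>
  Every edge of the tree joins some \<open>u\<close> to \<open>u @ [e]\<close>; its two ends are at different distance from \<open>x\<close>,
  and the nearer one is decided by whether \<open>u @ [e]\<close> is a prefix of \<open>x\<close>.
\<close>

lemma tree_dist_snoc_farther:
  "\<not> prefix (u @ [e]) x \<Longrightarrow> tree_dist x (u @ [e]) = tree_dist x u + 1"
  by (induction x u rule: tree_dist.induct) auto

lemma tree_dist_snoc_closer:
  "prefix (u @ [e]) x \<Longrightarrow> tree_dist x u = tree_dist x (u @ [e]) + 1"
  by (induction x u rule: tree_dist.induct) auto

locale universal_cover = bidirected_digraph G arev
  for G :: "('v, 'e) pre_digraph" and arev :: "'e \<Rightarrow> 'e" +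
  fixes x0 :: 'v
  assumes x0: "x0 \<in> verts G"
begin

abbreviation "T \<equiv> univ_cover G arev x0"
abbreviation "proj \<equiv> cover_proj G x0"

lemma tree_simps [simp]: "tail T = fst" "head T = snd"
  by (simp_all add: univ_cover_def)

lemma proj_snoc [simp]: "proj (p @ [a]) = head G a"
  by (simp add: cover_proj_def awalk_verts_conv)

lemma snoc_in_tree_iff:
  "p @ [a] \<in> verts T \<longleftrightarrow> p \<in> verts T \<and> a \<in> out_arcs G (proj p) \<and> (p \<noteq> [] \<longrightarrow> a \<noteq> arev (last p))"
  by (auto simp: univ_cover_def nb_paths_def cover_proj_def successively_append_iff awalk_Cons_iff awalk_Nil_iff)

lemma tree_prefix_closed: "p @ r \<in> verts T \<Longrightarrow> p \<in> verts T"
  by (induction r rule: rev_induct) (auto simp: snoc_in_tree_iff simp flip: append_assoc)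

text \<open>
  The vertex reached from \<open>w\<close> along the lift of the arc \<open>a\<close>: the walk \<open>w\<close> followed by \<open>a\<close>,
  reduced as in a free group. All neighbours of \<open>w\<close> arise in this way, each from a single arc.
\<close>

definition step :: "'e list \<Rightarrow> 'e \<Rightarrow> 'e list" where
  "step w a = (if w \<noteq> [] \<and> a = arev (last w) then butlast w else w @ [a])"

lemma step_cases:
  assumes "w \<in> verts T" "a \<in> out_arcs G (proj w)"
  obtains (backward) e where "w = step w a @ [e]" "a = arev e" "e \<in> arcs G"
  | (forward) "step w a = w @ [a]" "step w a \<in> verts T"
proof (cases "w \<noteq> [] \<and> a = arev (last w)")
  case True
  then obtain p e where w: "w = p @ [e]" by (metis append_butlast_last_id)
  then have "step w a = p" "e \<in> arcs G" "a = arev e" using True assms by (auto simp: step_def snoc_in_tree_iff)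
  then show ?thesis using backward w by simp
next
  case False
  then have "step w a = w @ [a]" unfolding step_def by (rule if_not_P)
  moreover have "w @ [a] \<in> verts T" using False assms by (auto simp: snoc_in_tree_iff)
  ultimately show ?thesis using forward by simp
qed

lemma step_snoc: "w @ [a] \<in> verts T \<Longrightarrow> step w a = w @ [a]" "step (w @ [a]) (arev a) = w"
  by (auto simp: step_def snoc_in_tree_iff)

lemma step_in_tree: "w \<in> verts T \<Longrightarrow> a \<in> out_arcs G (proj w) \<Longrightarrow> step w a \<in> verts T"
  by (metis step_cases tree_prefix_closed)

lemma proj_step:
  assumes "w \<in> verts T" "a \<in> out_arcs G (proj w)" shows "proj (step w a) = head G a"
  using assms
proof (cases rule: step_cases)
  case (backward e)
  then have "e \<in> out_arcs G (proj (step w a))"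
    using assms(1) snoc_in_tree_iff[of "step w a" e] by simp
  then show ?thesis using backward by simp
qed simp

lemma step_step_arev:
  assumes "w \<in> verts T" "a \<in> out_arcs G (proj w)" shows "step (step w a) (arev a) = w"
  using assms
proof (cases rule: step_cases)
  case (backward e)
  then show ?thesis using assms(1) step_snoc(1)[of "step w a" e] by simp
next
  case forward
  then show ?thesis by (simp add: step_snoc(2))
qed

lemma arev_in_out_arcs:
  assumes "w \<in> verts T" "a \<in> out_arcs G (proj w)" shows "arev a \<in> out_arcs G (proj (step w a))"
  using assms by (simp add: proj_step)

lemma arc_in_tree_iff:
  "(w, z) \<in> arcs T \<longleftrightarrow> w \<in> verts T \<and> (\<exists>a\<in>out_arcs G (proj w). z = step w a)"
proof
  assume "(w, z) \<in> arcs T"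
  then have wz: "w \<in> verts T" "z \<in> verts T" "\<exists>e. z = w @ [e] \<or> w = z @ [e]"
    by (auto simp: univ_cover_def)
  then consider e where "z = w @ [e]" | e where "w = z @ [e]" by blast
  then show "w \<in> verts T \<and> (\<exists>a\<in>out_arcs G (proj w). z = step w a)"
  proof cases
    case 1
    then have "e \<in> out_arcs G (proj w)" using wz snoc_in_tree_iff by blast
    then show ?thesis using wz 1 step_snoc(1)[of w e] by metis
  next
    case 2
    then have "arev e \<in> out_arcs G (proj w)" using wz by (auto simp: snoc_in_tree_iff)
    then show ?thesis using wz 2 step_snoc(2)[of z e] by metis
  qed
next
  assume "w \<in> verts T \<and> (\<exists>a\<in>out_arcs G (proj w). z = step w a)"
  then obtain a where a: "w \<in> verts T" "a \<in> out_arcs G (proj w)" "z = step w a" by blast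
  have "z = w @ [a] \<or> (\<exists>e. w = z @ [e])" using a(1,2) unfolding a(3) by (cases rule: step_cases) auto
  then show "(w, z) \<in> arcs T"
    using a(1) step_in_tree[OF a(1,2)] a(3) by (auto simp: univ_cover_def)
qed

lemma is_lift_step:
  assumes "is_lift G arev x0 a (w, z)"
  shows "w \<in> verts T" "a \<in> out_arcs G (proj w)" "z = step w a"
proof -
  have wz: "w \<in> verts T" "z \<in> verts T" "z = w @ [a] \<or> (\<exists>e. w = z @ [e] \<and> a = arev e)"
    using assms by (auto simp: is_lift_def univ_cover_def)
  then consider "z = w @ [a]" | e where "w = z @ [e]" "a = arev e" by blast
  then have "a \<in> out_arcs G (proj w) \<and> z = step w a"
  proof cases
    case 1
    then show ?thesis using wz step_snoc(1)[of w a] by (auto simp: snoc_in_tree_iff)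
  next
    case 2
    then show ?thesis using wz step_snoc(2)[of z e] by (auto simp: snoc_in_tree_iff)
  qed
  then show "w \<in> verts T" "a \<in> out_arcs G (proj w)" "z = step w a" using wz by auto
qed

lemma tree_dist_step:
  assumes "w \<in> verts T" "a \<in> out_arcs G (proj w)"
  shows "tree_dist x (step w a) = tree_dist x w + 1 \<or> tree_dist x w = tree_dist x (step w a) + 1"
  using assms
proof (cases rule: step_cases)
  case (backward e)
  then show ?thesis
    using tree_dist_snoc_farther[of "step w a" e x] tree_dist_snoc_closer[of "step w a" e x] by metis
next
  case forward
  then show ?thesis
    using tree_dist_snoc_farther[of w a x] tree_dist_snoc_closer[of w a x] by metis
qed

text \<open>
  The tree property behind all descriptions of arcs and horocycles: at most one neighbour of \<open>w\<close> is
  nearer to \<open>x\<close>. It is the parent of \<open>w\<close> if \<open>w\<close> is not a prefix of \<open>x\<close>, and otherwise the prefix of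
  \<open>x\<close> that is longer by one letter.
\<close>

lemma unique_step_closer:
  assumes w: "w \<in> verts T" and a: "a \<in> out_arcs G (proj w)" and b: "b \<in> out_arcs G (proj w)"
    and closer: "tree_dist x (step w a) < tree_dist x w" and "a \<noteq> b"
  shows "tree_dist x (step w b) = tree_dist x w + 1"
proof (rule ccontr)
  assume "\<not> ?thesis"
  then have closer': "tree_dist x (step w b) < tree_dist x w" using tree_dist_step[OF w b, of x] by simp
  have *: "(\<exists>e. c = arev e \<and> (\<exists>u. w = u @ [e]) \<and> \<not> prefix w x) \<or> prefix (w @ [c]) x"
    if c: "c \<in> out_arcs G (proj w)" "tree_dist x (step w c) < tree_dist x w" for c
    using w c(1)
  proof (cases rule: step_cases)
    case (backward e)
    then have "\<not> prefix w x" using tree_dist_snoc_closer[of "step w c" e x] c(2) by auto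
    then show ?thesis using backward by blast
  next
    case forward
    then show ?thesis using tree_dist_snoc_farther[of w c x] c(2) by auto
  qed
  from *[OF a closer] *[OF b closer'] \<open>a \<noteq> b\<close> show False
    by (auto dest: append_prefixD simp: prefix_def)
qed

lemma step_closer_exists:
  assumes w: "w \<in> verts T" and x: "x \<in> verts T" and "w \<noteq> x"
  obtains a where "a \<in> out_arcs G (proj w)" "tree_dist x w = tree_dist x (step w a) + 1"
proof (cases "prefix w x")
  case True
  then obtain e r where "x = w @ e # r" using \<open>w \<noteq> x\<close>
    by (metis append.right_neutral neq_Nil_conv prefixE)
  then have pre: "prefix (w @ [e]) x" and mem: "w @ [e] \<in> verts T"
    using x tree_prefix_closed[of "w @ [e]" r] by auto
  show thesis
    using that[of e] mem step_snoc(1)[OF mem] tree_dist_snoc_closer[OF pre]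
    by (auto simp: snoc_in_tree_iff)
next
  case False
  then obtain u e where u: "w = u @ [e]" by (metis Nil_prefix rev_exhaust)
  then have "arev e \<in> out_arcs G (proj w)" using w by (auto simp: snoc_in_tree_iff)
  then show thesis
    using that[of "arev e"] False tree_dist_snoc_farther[of u e x] by (simp add: u step_snoc(2))
qed

lemma wf_tree: "wf_digraph T"
  by unfold_locales (auto simp: univ_cover_def)

lemma tree_dist_le_length_awalk:
  assumes "pre_digraph.awalk T x p w" shows "tree_dist x w \<le> length p"
proof -
  interpret T: wf_digraph T by (rule wf_tree)
  show ?thesis using assms
  proof (induction p arbitrary: w rule: rev_induct)
    case Nil
    then show ?case by (auto simp: T.awalk_Nil_iff)
  next
    case (snoc b p)
    then have b: "b \<in> arcs T" "w = snd b" "T.awalk x p (fst b)"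
      by (auto simp: T.awalk_Cons_iff)
    then obtain a where a: "fst b \<in> verts T" "a \<in> out_arcs G (proj (fst b))" "w = step (fst b) a"
      using arc_in_tree_iff[of "fst b" "snd b"] by auto
    show ?case using snoc.IH[OF b(3)] tree_dist_step[OF a(1,2), of x] a(3) by auto
  qed
qed

lemma awalk_of_tree_dist:
  assumes x: "x \<in> verts T" and w: "w \<in> verts T"
  shows "\<exists>p. pre_digraph.awalk T x p w \<and> length p = tree_dist x w"
proof -
  interpret T: wf_digraph T by (rule wf_tree)
  show ?thesis using w
  proof (induction "tree_dist x w" arbitrary: w)
    case 0
    then show ?case using x by (auto simp: T.awalk_Nil_iff)
  next
    case (Suc n)
    then obtain a where a: "a \<in> out_arcs G (proj w)" "tree_dist x w = tree_dist x (step w a) + 1"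
      using step_closer_exists[OF Suc.prems x] by (metis nat.simps(3) tree_dist_eq_0)
    let ?z = "step w a"
    have z: "?z \<in> verts T" by (rule step_in_tree[OF Suc.prems a(1)])
    then obtain p where p: "T.awalk x p ?z" "length p = n"
      using Suc.hyps(1)[of ?z] Suc.hyps(2) a(2) by auto
    have "(?z, w) \<in> arcs T"
      unfolding arc_in_tree_iff
      using z step_step_arev[OF Suc.prems a(1), symmetric] arev_in_out_arcs[OF Suc.prems a(1)] by blast
    then have "T.awalk x (p @ [(?z, w)]) w"
      using p Suc.prems by (auto simp: T.awalk_Cons_iff T.awalk_Nil_iff)
    moreover have "length (p @ [(?z, w)]) = tree_dist x w" using p(2) Suc.hyps(2) by simp
    ultimately show ?case by blast
  qed
qed

lemma graph_dist_tree: "x \<in> verts T \<Longrightarrow> w \<in> verts T \<Longrightarrow> graph_dist T x w = tree_dist x w"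
  unfolding graph_dist_def using awalk_of_tree_dist tree_dist_le_length_awalk
  by (intro Least_equality) auto

lemma graph_sphere_tree: "w \<in> verts T \<Longrightarrow> graph_sphere T r w = {x \<in> verts T. tree_dist x w = r}"
  by (auto simp: graph_sphere_def graph_dist_tree)

lemma arc_set_tree:
  assumes "w \<in> verts T" "a \<in> out_arcs G (proj w)"
  shows "arc_set T (Suc r) (w, step w a) =
         {x \<in> verts T. tree_dist x w = Suc r \<and> tree_dist x (step w a) = r}"
  using assms by (auto simp: graph_sphere_tree step_in_tree)

lemma arc_set_1:
  assumes "w \<in> verts T" "a \<in> out_arcs G (proj w)"
  shows "arc_set T (Suc 0) (w, step w a) = {step w a}"
  using tree_dist_step[OF assms, of "step w a"] step_in_tree[OF assms]
  unfolding arc_set_tree[OF assms] by auto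

text \<open>
  The arcs of radius \<open>r + 2\<close> branch at the head of the initial edge: a point that is farther from \<open>w\<close>
  than from its neighbour \<open>step w a\<close> is nearer to exactly one neighbour of the latter, and this is
  not \<open>w\<close>.
\<close>

lemma arc_set_Suc:
  assumes w: "w \<in> verts T" and a: "a \<in> out_arcs G (proj w)"
  shows "arc_set T (Suc (Suc r)) (w, step w a) =
         (\<Union>b \<in> out_arcs G (head G a) - {arev a}. arc_set T (Suc r) (step w a, step (step w a) b))"
    (is "?L = ?R")
proof -
  let ?z = "step w a"
  have z: "?z \<in> verts T" by (rule step_in_tree[OF w a])
  have pz: "proj ?z = head G a" by (rule proj_step[OF w a])
  have reverse: "arev a \<in> out_arcs G (proj ?z)" "step ?z (arev a) = w"
    using arev_in_out_arcs[OF w a] step_step_arev[OF w a] by auto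
  show ?thesis
  proof (intro subset_antisym subsetI)
    fix x assume "x \<in> ?L"
    then have x: "x \<in> verts T" "tree_dist x w = Suc (Suc r)" "tree_dist x ?z = Suc r"
      unfolding arc_set_tree[OF w a] by auto
    then obtain b where b: "b \<in> out_arcs G (proj ?z)" "tree_dist x ?z = tree_dist x (step ?z b) + 1"
      using step_closer_exists[OF z x(1)] by (metis nat.simps(3) tree_dist_eq_0)
    have "b \<noteq> arev a"
    proof
      assume "b = arev a"
      then have "step ?z b = w" by (simp only: reverse(2))
      then show False using b(2) x(2,3) by simp
    qed
    moreover have "x \<in> arc_set T (Suc r) (?z, step ?z b)"
      unfolding arc_set_tree[OF z b(1)] using b x by simp
    ultimately show "x \<in> ?R" using b(1) unfolding pz by blast
  next
    fix x assume "x \<in> ?R"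
    then obtain b where b: "b \<in> out_arcs G (proj ?z)" "b \<noteq> arev a"
      and "x \<in> arc_set T (Suc r) (?z, step ?z b)" unfolding pz by blast
    then have x: "x \<in> verts T" "tree_dist x ?z = Suc r" "tree_dist x (step ?z b) = r"
      unfolding arc_set_tree[OF z b(1)] by auto
    then have "tree_dist x w = Suc (Suc r)"
      using unique_step_closer[OF z b(1) reverse(1), of x] b(2) reverse(2) by simp
    then show "x \<in> ?L" using x unfolding arc_set_tree[OF w a] by simp
  qed
qed

lemma arc_set_disjoint:
  assumes w: "w \<in> verts T" and a: "a \<in> out_arcs G (proj w)" and b: "b \<in> out_arcs G (proj w)"
    and "a \<noteq> b"
  shows "arc_set T (Suc r) (w, step w a) \<inter> arc_set T (Suc r) (w, step w b) = {}"
  using unique_step_closer[OF w a b _ \<open>a \<noteq> b\<close>]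
  unfolding arc_set_tree[OF w a] arc_set_tree[OF w b] by fastforce


section \<open>Horocycles are tree arcs\<close>

lemma geodesic_steps:
  assumes geo: "geodesic T \<gamma>"
  shows "\<gamma> i \<in> verts T"
    and "\<exists>a\<in>out_arcs G (proj (\<gamma> (i + 1))). \<gamma> i = step (\<gamma> (i + 1)) a"
    and "\<exists>a\<in>out_arcs G (proj (\<gamma> i)). \<gamma> (i + 1) = step (\<gamma> i) a"
proof -
  show mem: "\<gamma> i \<in> verts T" using geo by (simp add: geodesic_def)
  have "(\<gamma> i, \<gamma> (i + 1)) \<in> arcs T"
    using geo by (auto simp: geodesic_def arcs_ends_conv)
  then show "\<exists>a\<in>out_arcs G (proj (\<gamma> i)). \<gamma> (i + 1) = step (\<gamma> i) a"
    unfolding arc_in_tree_iff by blast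
  then obtain a where a: "a \<in> out_arcs G (proj (\<gamma> i))" "\<gamma> (i + 1) = step (\<gamma> i) a" by blast
  show "\<exists>a\<in>out_arcs G (proj (\<gamma> (i + 1))). \<gamma> i = step (\<gamma> (i + 1)) a"
    unfolding a(2) using step_step_arev[OF mem a(1), symmetric] arev_in_out_arcs[OF mem a(1)] by blast
qed

lemma geodesic_dist_step:
  assumes "geodesic T \<gamma>"
  shows "tree_dist x (\<gamma> (i + 1)) = tree_dist x (\<gamma> i) + 1 \<or>
         tree_dist x (\<gamma> i) = tree_dist x (\<gamma> (i + 1)) + 1"
  using geodesic_steps(1,3)[OF assms, of i] tree_dist_step by metis

text \<open>
  Of the two neighbours of a point of the geodesic, the previous one is nearer to \<open>x\<close>, so the next one
  cannot be nearer as well: once a geodesic leads away from \<open>x\<close>, it does so forever.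
\<close>

lemma geodesic_dist_keeps_increasing:
  assumes geo: "geodesic T \<gamma>" and incr: "tree_dist x (\<gamma> (i + 1)) = tree_dist x (\<gamma> i) + 1"
  shows "tree_dist x (\<gamma> (i + 2)) = tree_dist x (\<gamma> (i + 1)) + 1"
proof -
  let ?w = "\<gamma> (i + 1)"
  obtain a where a: "a \<in> out_arcs G (proj ?w)" "\<gamma> i = step ?w a"
    using geodesic_steps(2)[OF geo] by blast
  obtain b where b: "b \<in> out_arcs G (proj ?w)" "\<gamma> (i + 2) = step ?w b"
    using geodesic_steps(3)[OF geo, of "i + 1"] by (auto simp: add.assoc)
  have "\<gamma> i \<noteq> \<gamma> (i + 2)" using geo by (simp add: geodesic_def)
  then have "a \<noteq> b" using a b by auto
  then show ?thesis
    using unique_step_closer[OF geodesic_steps(1)[OF geo] a(1) b(1), of x] a(2) b(2) incr by simp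
qed

lemma geodesic_dist_increasing:
  assumes geo: "geodesic T \<gamma>" and incr: "tree_dist x (\<gamma> (i + 1)) = tree_dist x (\<gamma> i) + 1"
  shows "tree_dist x (\<gamma> (i + int n)) = tree_dist x (\<gamma> i) + n"
proof -
  have "tree_dist x (\<gamma> (i + int n)) = tree_dist x (\<gamma> i) + n \<and>
        tree_dist x (\<gamma> (i + int n + 1)) = tree_dist x (\<gamma> i) + n + 1"
  proof (induction n)
    case (Suc n)
    then show ?case
      using geodesic_dist_keeps_increasing[OF geo, of x "i + int n"] by (simp add: add_ac)
  qed (simp add: incr)
  then show ?thesis ..
qed

lemma geodesic_dist_le:
  assumes geo: "geodesic T \<gamma>"
  shows "tree_dist x (\<gamma> (i + int n)) \<le> tree_dist x (\<gamma> i) + n"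
proof (induction n)
  case (Suc n)
  then show ?case using geodesic_dist_step[OF geo, of x "i + int n"] by (auto simp: add_ac)
qed simp

text \<open>
  The distance changes by one in each step and cannot decrease forever.
\<close>

lemma geodesic_dist_eventually_increasing:
  assumes geo: "geodesic T \<gamma>"
  obtains n :: nat where "tree_dist x (\<gamma> (i + int n + 1)) = tree_dist x (\<gamma> (i + int n)) + 1"
proof (rule ccontr)
  assume "\<not> thesis"
  then have decr: "tree_dist x (\<gamma> (i + int n)) = tree_dist x (\<gamma> (i + int n + 1)) + 1" for n
    using that geodesic_dist_step[OF geo] by blast
  have "tree_dist x (\<gamma> (i + int n)) + n = tree_dist x (\<gamma> i)" for n
  proof (induction n)
    case (Suc n)
    then show ?case using decr[of n] by (simp add: add_ac)
  qed simp
  from this[of "Suc (tree_dist x (\<gamma> i))"] show False by simp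
qed

text \<open>
  From the time when the geodesic leads away from \<open>x\<close>, the sequence in the limit is constant.
\<close>

lemma busemann_eq:
  assumes geo: "geodesic T \<gamma>" and x: "x \<in> verts T"
    and incr: "tree_dist x (\<gamma> (int k + 1)) = tree_dist x (\<gamma> (int k)) + 1"
  shows "busemann T \<gamma> 0 x = real (tree_dist x (\<gamma> (int k))) - real k"
proof -
  have "\<forall>\<^sub>F n in sequentially.
    real (graph_dist T x (\<gamma> (0 + int n))) - real n = real (tree_dist x (\<gamma> (int k))) - real k"
  proof (rule eventually_sequentiallyI)
    fix n assume "k \<le> n"
    then show "real (graph_dist T x (\<gamma> (0 + int n))) - real n
        = real (tree_dist x (\<gamma> (int k))) - real k"
      using geodesic_dist_increasing[OF geo incr, of "n - k"]
      by (simp add: graph_dist_tree[OF x geodesic_steps(1)[OF geo]] of_nat_diff)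
  qed
  then show ?thesis
    unfolding busemann_def by (intro limI tendsto_eventually)
qed

text \<open>
  Let \<open>x\<close> have distance \<open>r\<close> from \<open>\<gamma> r\<close>. If the geodesic leads away from \<open>x\<close> already at time \<open>r\<close>, the
  Busemann function at \<open>x\<close> is \<open>r - r = 0\<close>. Otherwise the distance to \<open>\<gamma> (r + 1)\<close> is only \<open>r - 1\<close>, and
  since it grows by at most one per step, the Busemann function is at most \<open>-2\<close>.
\<close>

lemma horocycle_part_eq_arc_set:
  assumes geo: "geodesic T \<gamma>"
  shows "horocycle_part T \<gamma> r = arc_set T (Suc r) (\<gamma> (int r + 1), \<gamma> (int r))"
proof -
  have "busemann T \<gamma> 0 x = 0 \<longleftrightarrow> tree_dist x (\<gamma> (int r + 1)) = Suc r"
    if x: "x \<in> verts T" and xr: "tree_dist x (\<gamma> (int r)) = r" for x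
  proof
    assume "tree_dist x (\<gamma> (int r + 1)) = Suc r"
    then show "busemann T \<gamma> 0 x = 0" using busemann_eq[OF geo x, of r] xr by simp
  next
    assume bus: "busemann T \<gamma> 0 x = 0"
    show "tree_dist x (\<gamma> (int r + 1)) = Suc r"
    proof (rule ccontr)
      assume "\<not> ?thesis"
      then have decr: "tree_dist x (\<gamma> (int r + 1)) + 1 = r"
        using geodesic_dist_step[OF geo, of x "int r"] xr by auto
      \<comment> \<open>The geodesic leads away from \<open>x\<close> at a later time, from which the Busemann function is read off.\<close>
      obtain n where n: "tree_dist x (\<gamma> (int r + 1 + int n + 1)) = tree_dist x (\<gamma> (int r + 1 + int n)) + 1"
        by (rule geodesic_dist_eventually_increasing[OF geo])
      let ?k = "r + 1 + n"
      have "busemann T \<gamma> 0 x = real (tree_dist x (\<gamma> (int ?k))) - real ?k"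
        using n by (intro busemann_eq[OF geo x]) (simp add: add_ac)
      moreover have "tree_dist x (\<gamma> (int ?k)) \<le> tree_dist x (\<gamma> (int r + 1)) + n"
        using geodesic_dist_le[OF geo, of x "int r + 1" n] by (simp add: add_ac)
      ultimately show False using bus decr by simp
    qed
  qed
  then show ?thesis
    using graph_sphere_tree[OF geodesic_steps(1)[OF geo]]
    by (auto simp: horocycle_part_def horocycle_def)
qed

end

section \<open>Averages over tree arcs\<close>

locale regular_universal_cover =
  regular_multigraph G arev q + universal_cover G arev x0
  for G :: "('v, 'e) pre_digraph" and arev :: "'e \<Rightarrow> 'e" and q :: nat and x0 :: 'v
begin

lemma arc_set_Suc_nb_succ:
  assumes "w \<in> verts T" "a \<in> out_arcs G (proj w)"
  shows "arc_set T (Suc (Suc r)) (w, step w a) =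
         (\<Union>b\<in>nb_succ a. arc_set T (Suc r) (step w a, step (step w a) b))"
  unfolding nb_succ_def by (rule arc_set_Suc[OF assms])

lemma finite_arc_set:
  assumes "w \<in> verts T" "a \<in> out_arcs G (proj w)"
  shows "finite (arc_set T (Suc r) (w, step w a))"
  using assms
proof (induction r arbitrary: w a)
  case 0
  show ?case unfolding arc_set_1[OF 0] by simp
next
  case (Suc r)
  have "b \<in> out_arcs G (proj (step w a))" if "b \<in> nb_succ a" for b
    using that proj_step[OF Suc.prems] by (simp add: in_nb_succ)
  then show ?case
    unfolding arc_set_Suc_nb_succ[OF Suc.prems] using step_in_tree[OF Suc.prems]
    by (intro finite_UN_I finite_nb_succ Suc.IH) auto
qed

text \<open>
  By induction on the radius: the branching of arcs in the tree is the branching of the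
  non-backtracking walk, and the pieces are disjoint, so no end point is counted twice.
\<close>

lemma sum_arc_set:
  assumes "w \<in> verts T" "a \<in> out_arcs G (proj w)"
  shows "(\<Sum>x\<in>arc_set T (Suc r) (w, step w a). f (proj x)) =
         real q ^ r * (nb_avg ^^ r) (\<lambda>b. f (head G b)) a"
  using assms
proof (induction r arbitrary: w a)
  case 0
  then show ?case unfolding arc_set_1[OF 0] by (simp add: proj_step)
next
  case (Suc r)
  let ?h = "(nb_avg ^^ r) (\<lambda>b. f (head G b))"
  let ?z = "step w a"
  have z: "?z \<in> verts T" by (rule step_in_tree[OF Suc.prems])
  have b: "b \<in> out_arcs G (proj ?z)" if "b \<in> nb_succ a" for b
    using that proj_step[OF Suc.prems] by (simp add: in_nb_succ)
  have "(\<Sum>x\<in>arc_set T (Suc (Suc r)) (w, ?z). f (proj x)) =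
        (\<Sum>b\<in>nb_succ a. \<Sum>x\<in>arc_set T (Suc r) (?z, step ?z b). f (proj x))"
    unfolding arc_set_Suc_nb_succ[OF Suc.prems]
    by (intro sum.UNION_disjoint finite_nb_succ ballI impI finite_arc_set arc_set_disjoint z b)
  also have "\<dots> = (\<Sum>b\<in>nb_succ a. real q ^ r * ?h b)"
    by (intro sum.cong refl Suc.IH z b)
  also have "\<dots> = real q ^ Suc r * nb_avg ?h a"
    using q_ge_2 by (simp add: nb_avg_def flip: sum_distrib_left)
  finally show ?case by simp
qed

lemma nb_avg_funpow_const:
  "a \<in> arcs G \<Longrightarrow> (nb_avg ^^ n) (\<lambda>_. 1) a = 1"
proof (induction n arbitrary: a)
  case (Suc n)
  have "(\<Sum>b\<in>nb_succ a. (nb_avg ^^ n) (\<lambda>_. 1) b) = (\<Sum>b\<in>nb_succ a. 1)"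
    by (intro sum.cong refl Suc.IH) (simp add: in_nb_succ)
  then show ?case using Suc.prems q_ge_2 by (simp add: nb_avg_def[of "(nb_avg ^^ n) (\<lambda>_. 1)"] card_nb_succ)
qed simp

lemma average_arc_set:
  assumes "w \<in> verts T" "a \<in> out_arcs G (proj w)"
  shows "average (lift_fun G x0 f) (arc_set T (Suc r) (w, step w a)) =
         (nb_avg ^^ r) (\<lambda>b. f (head G b)) a"
proof -
  have "real (card (arc_set T (Suc r) (w, step w a))) = real q ^ r"
    using sum_arc_set[OF assms, of "\<lambda>_. 1" r] assms(2) by (simp add: nb_avg_funpow_const)
  then show ?thesis
    using sum_arc_set[OF assms, of f r] q_ge_2 by (simp add: average_def lift_fun_def)
qed

end


section \<open>Equidistribution of arcs and horocycles\<close>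

theorem theorem4:
  fixes G :: "('v, 'e) pre_digraph" and arev :: "'e \<Rightarrow> 'e" and q :: nat
  assumes "fin_digraph G"
    and "bidirected_digraph G arev"
    and "Digraph_Component.connected G"
    and "\<not> bipartite G"
    and "\<forall>v\<in>verts G. out_degree G v = q + 1"
    and "q + 1 \<ge> 3"
  shows "\<exists>C_G::real. C_G > 0 \<and> (\<forall>f :: 'v \<Rightarrow> real. \<exists>\<beta>_max::real.
           real q powr (- (1/2)) \<le> \<beta>_max \<and> \<beta>_max < 1 \<and>
           (\<forall>x0\<in>verts G.
              (\<forall>a\<in>arcs G. \<forall>b. is_lift G arev x0 a b \<longrightarrow> (\<forall>r::nat.
                 \<bar>average (lift_fun G x0 f) (arc_set (univ_cover G arev x0) r b)
                    - average f (verts G)\<bar> \<le> C_G * L2_set f (verts G) * \<beta>_max ^ r)) \<and>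
              (\<forall>\<gamma>. geodesic (univ_cover G arev x0) \<gamma> \<longrightarrow> (\<forall>r::nat.
                 \<bar>average (lift_fun G x0 f) (horocycle_part (univ_cover G arev x0) \<gamma> r)
                    - average f (verts G)\<bar> \<le> C_G * L2_set f (verts G) * \<beta>_max ^ r))))"
proof -
  interpret regular_multigraph G arev q
    by (intro regular_multigraph.intro regular_multigraph_axioms.intro) (use assms in auto)
  obtain N where N: "N > 0" "\<And>a. a \<in> arcs G \<Longrightarrow> nb_reach N a = arcs G"
    using nb_walk_primitive[OF assms(3,4)] by blast
  define \<epsilon> where "\<epsilon> = 1 - 1 / real q ^ N"
  define \<beta> where "\<beta> = max (root N \<epsilon>) (real q powr (- (1/2)))"
  \<comment> \<open>One factor \<open>\<beta>\<close> in the denominator absorbs the first edge, the others are lost in the mixing estimate;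
    the numerator bounds the length \<open>2 * L2_set f (verts G)\<close> of an interval with all values of \<open>f\<close>.\<close>
  define C where "C = 2 / \<beta> ^ Suc N"
  have \<epsilon>: "0 \<le> \<epsilon>" "\<epsilon> < 1" using q_ge_2 by (auto simp: \<epsilon>_def)
  have pos: "0 < \<beta>" using q_ge_2 by (auto simp: \<beta>_def less_max_iff_disj)
  have lt1: "\<beta> < 1"
    using \<epsilon> N(1) q_ge_2 by (auto simp: \<beta>_def powr_less_one)
  have "\<epsilon> = root N \<epsilon> ^ N" using \<epsilon> N(1) by simp
  also have "\<dots> \<le> \<beta> ^ N" using \<epsilon> by (intro power_mono) (auto simp: \<beta>_def real_root_ge_zero)
  finally have \<beta>N: "1 - 1 / real q ^ N \<le> \<beta> ^ N" by (simp add: \<epsilon>_def)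
  have "\<beta> ^ Suc N \<le> 1" using pos lt1 by (intro power_le_one) auto
  then have C2: "C \<ge> 2" using pos by (simp add: C_def pos_le_divide_eq del: power_Suc)
  have main:
    "\<bar>average (lift_fun G x0 f) (arc_set (univ_cover G arev x0) r (w, z)) - average f (verts G)\<bar>
      \<le> C * L2_set f (verts G) * \<beta> ^ r"
    if x0: "x0 \<in> verts G" and w: "w \<in> verts (univ_cover G arev x0)"
      and a: "a \<in> out_arcs G (cover_proj G x0 w)" and z: "z = universal_cover.step arev w a"
    for x0 f r w z a
  proof -
    interpret regular_universal_cover G arev q x0 by unfold_locales (rule x0)
    let ?L = "L2_set f (verts G)"
    have bound: "f v \<in> {- ?L..?L}" if "v \<in> verts G" for v
      using abs_le_L2_set[of "verts G" v f] that by (auto simp: abs_le_iff)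
    have aG: "a \<in> arcs G" and aw: "tail G a = proj w" using a by auto
    have ne: "verts G \<noteq> {}" using x0 by auto
    show ?thesis
    proof (cases r)
      case 0
      have "f (proj w) \<in> {- ?L..?L}" using bound[OF tail_in_verts[OF aG]] aw by simp
      moreover have "average f (verts G) \<in> {- ?L..?L}"
        using bound ne by (intro average_in_interval) auto
      ultimately have "\<bar>f (proj w) - average f (verts G)\<bar> \<le> 2 * ?L" by (auto simp: abs_le_iff)
      also have "\<dots> \<le> C * ?L" using C2 by (intro mult_right_mono) auto
      finally show ?thesis using 0 by (simp add: average_def lift_fun_def)
    next
      case (Suc n)
      have "\<bar>(nb_avg ^^ n) (\<lambda>b. f (head G b)) a - average (\<lambda>b. f (head G b)) (arcs G)\<bar>
          \<le> (?L - (- ?L)) * (\<beta> ^ n / \<beta> ^ N)"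
        using pos lt1 \<beta>N aG bound by (intro nb_avg_mixing[OF N(2,1)]) auto
      also have "\<dots> = C * ?L * \<beta> ^ r"
        using pos by (simp add: C_def Suc field_simps)
      finally show ?thesis
        unfolding z Suc average_arc_set[OF w a] average_head[OF ne] .
    qed
  qed
  have arcs:
    "\<bar>average (lift_fun G x0 f) (arc_set (univ_cover G arev x0) r b) - average f (verts G)\<bar>
      \<le> C * L2_set f (verts G) * \<beta> ^ r"
    if x0: "x0 \<in> verts G" and lift: "is_lift G arev x0 a b" for f x0 a b r
  proof -
    interpret regular_universal_cover G arev q x0 by unfold_locales (rule x0)
    obtain w z where [simp]: "b = (w, z)" by (cases b)
    show ?thesis using main[OF x0] is_lift_step[of a w z] lift by simp
  qed
  have horocycles:
    "\<bar>average (lift_fun G x0 f) (horocycle_part (univ_cover G arev x0) \<gamma> r) - average f (verts G)\<bar>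
      \<le> C * L2_set f (verts G) * \<beta> ^ r"
    if x0: "x0 \<in> verts G" and geo: "geodesic (univ_cover G arev x0) \<gamma>" for f x0 \<gamma> r
  proof -
    interpret regular_universal_cover G arev q x0 by unfold_locales (rule x0)
    obtain a where a: "a \<in> out_arcs G (proj (\<gamma> (int r + 1)))" "\<gamma> (int r) = step (\<gamma> (int r + 1)) a"
      using geodesic_steps(2)[OF geo] by blast
    \<comment> \<open>The arc has radius \<open>r + 1\<close>, which is better than required by a factor \<open>\<beta>\<close>.\<close>
    have "\<bar>average (lift_fun G x0 f) (horocycle_part T \<gamma> r) - average f (verts G)\<bar>
        \<le> C * L2_set f (verts G) * \<beta> ^ Suc r"
      unfolding horocycle_part_eq_arc_set[OF geo]
      by (rule main[OF x0 geodesic_steps(1)[OF geo] a])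
    also have "\<dots> \<le> C * L2_set f (verts G) * \<beta> ^ r"
      using C2 pos lt1 by (intro mult_left_mono power_decreasing mult_nonneg_nonneg) auto
    finally show ?thesis .
  qed
  have "C > 0" and "real q powr (- (1/2)) \<le> \<beta>" using C2 by (auto simp: \<beta>_def)
  then show ?thesis using lt1 arcs horocycles by blast
qed

end
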